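(* Let $\mathcal{D}$ be a well generated triangulated category and let $\sigma_1,\sigma_2$ be objects of $\mathcal{D}$ such that $\mathrm{Hom}_{\mathcal{D}}(\sigma_1,\sigma_1[k])=0$ and $\mathrm{Hom}_{\mathcal{D}}(\sigma_2,\sigma_2[k])=0$ for all $k>0$, $\mathrm{Hom}_{\mathcal{D}}(\sigma_1,\sigma_2[k])=0$ for all $k\ge 0$, and $\mathrm{Hom}_{\mathcal{D}}(\sigma_2,\sigma_1[k])=0$ for all $k\ge 2$. Let $\alpha\colon\sigma_2\to\sigma_1[1]$ be a morphism and let $\tilde\sigma$ be the object defined by the triangle $$\sigma_1\to\tilde\sigma\to\sigma_2\xrightarrow{\alpha}\sigma_1[1].$$ Then the following hold. (1) $\tilde\sigma\oplus\sigma_2\in(\tilde\sigma\oplus\sigma_2)^{\perp_{>0}}$ if and only if the morphism $\alpha\colon\sigma_2\to\sigma_1[1]$ is left universal. (2) $\tilde\sigma\oplus\sigma_1\in(\tilde\sigma\oplus\sigma_1)^{\perp_{>0}}$ if and only if the morphism $\alpha\colon\sigma_2\to\sigma_1[1]$ is right universal.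
   Context: Well generated is meant in the sense of Neeman/Krause. $X^{\perp_{>0}}$ is the class of objects $Y$ with $\mathrm{Hom}_{\mathcal{D}}(X,Y[i])=0$ for all $i>0$. A map $\alpha\colon M\to N$ is left universal if $\mathrm{Hom}_{\mathcal{D}}(M,\alpha)\colon\mathrm{End}_{\mathcal{D}}(M)\to\mathrm{Hom}_{\mathcal{D}}(M,N)$ is surjective, and right universal if $\mathrm{Hom}_{\mathcal{D}}(\alpha,N)\colon\mathrm{End}_{\mathcal{D}}(N)\to\mathrm{Hom}_{\mathcal{D}}(M,N)$ is surjective. *)

theory Defs
  imports "HOL-Algebra.Group"
begin

unbundle cardinal_syntax

section \<open>Categories\<close>

record ('o, 'm) category_data =
  Obj :: "'o set"
  Arr :: "'m set"
  Dom :: "'m \<Rightarrow> 'o"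
  Cod :: "'m \<Rightarrow> 'o"
  Ident :: "'o \<Rightarrow> 'm"
  Comp :: "'m \<Rightarrow> 'm \<Rightarrow> 'm" (infixl "\<cdot>\<index>" 70)

definition Hom :: "('o, 'm, 'b) category_data_scheme \<Rightarrow> 'o \<Rightarrow> 'o \<Rightarrow> 'm set" where
  "Hom D x y = {f \<in> Arr D. Dom D f = x \<and> Cod D f = y}"

definition iso_arr :: "('o, 'm, 'b) category_data_scheme \<Rightarrow> 'o \<Rightarrow> 'o \<Rightarrow> 'm \<Rightarrow> bool" where
  "iso_arr D x y f \<longleftrightarrow> f \<in> Hom D x y \<and>
     (\<exists>g\<in>Hom D y x. g \<cdot>\<^bsub>D\<^esub> f = Ident D x \<and> f \<cdot>\<^bsub>D\<^esub> g = Ident D y)"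

locale cat =
  fixes D :: "('o, 'm, 'b) category_data_scheme" (structure)
  assumes Dom_in: "f \<in> Arr D \<Longrightarrow> Dom D f \<in> Obj D"
    and Cod_in: "f \<in> Arr D \<Longrightarrow> Cod D f \<in> Obj D"
    and Ident_in: "x \<in> Obj D \<Longrightarrow> Ident D x \<in> Hom D x x"
    and Comp_in: "\<lbrakk>f \<in> Hom D x y; g \<in> Hom D y z\<rbrakk> \<Longrightarrow> g \<cdot> f \<in> Hom D x z"
    and Comp_Ident: "f \<in> Hom D x y \<Longrightarrow> f \<cdot> Ident D x = f"
    and Ident_Comp: "f \<in> Hom D x y \<Longrightarrow> Ident D y \<cdot> f = f"
    and Comp_assoc: "\<lbrakk>f \<in> Hom D w x; g \<in> Hom D x y; h \<in> Hom D y z\<rbrakk>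
      \<Longrightarrow> h \<cdot> (g \<cdot> f) = (h \<cdot> g) \<cdot> f"

section \<open>Additive categories\<close>

record ('o, 'm) additive_data = "('o, 'm) category_data" +
  Plus :: "'m \<Rightarrow> 'm \<Rightarrow> 'm" (infixl "\<boxplus>\<index>" 65)
  Zero :: "'o \<Rightarrow> 'o \<Rightarrow> 'm"

definition Hom_group :: "('o, 'm, 'b) additive_data_scheme \<Rightarrow> 'o \<Rightarrow> 'o \<Rightarrow> 'm monoid" where
  "Hom_group D x y = \<lparr>carrier = Hom D x y, mult = Plus D, one = Zero D x y\<rparr>"

definition zero_obj :: "('o, 'm, 'b) additive_data_scheme \<Rightarrow> 'o \<Rightarrow> bool" where
  "zero_obj D z \<longleftrightarrow> z \<in> Obj D \<and>
     (\<forall>x\<in>Obj D. Hom D x z = {Zero D x z} \<and> Hom D z x = {Zero D z x})"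

definition biproduct ::
  "('o, 'm, 'b) additive_data_scheme \<Rightarrow> 'o \<Rightarrow> 'o \<Rightarrow> 'o \<Rightarrow> 'm \<Rightarrow> 'm \<Rightarrow> 'm \<Rightarrow> 'm \<Rightarrow> bool" where
  "biproduct D x y s i j p q \<longleftrightarrow>
     i \<in> Hom D x s \<and> j \<in> Hom D y s \<and> p \<in> Hom D s x \<and> q \<in> Hom D s y \<and>
     p \<cdot>\<^bsub>D\<^esub> i = Ident D x \<and> q \<cdot>\<^bsub>D\<^esub> j = Ident D y \<and>
     p \<cdot>\<^bsub>D\<^esub> j = Zero D y x \<and> q \<cdot>\<^bsub>D\<^esub> i = Zero D x y \<and>
     (i \<cdot>\<^bsub>D\<^esub> p) \<boxplus>\<^bsub>D\<^esub> (j \<cdot>\<^bsub>D\<^esub> q) = Ident D s"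

text \<open>Direct sums are determined only up to isomorphism, so \<open>s = x \<oplus> y\<close> is rendered as a
  relation.\<close>

definition direct_sum :: "('o, 'm, 'b) additive_data_scheme \<Rightarrow> 'o \<Rightarrow> 'o \<Rightarrow> 'o \<Rightarrow> bool" where
  "direct_sum D x y s \<longleftrightarrow> s \<in> Obj D \<and> (\<exists>i j p q. biproduct D x y s i j p q)"

locale additive_cat = cat D for D :: "('o, 'm, 'b) additive_data_scheme" (structure) +
  assumes Hom_comm_group: "\<lbrakk>x \<in> Obj D; y \<in> Obj D\<rbrakk> \<Longrightarrow> comm_group (Hom_group D x y)"
    and Comp_Plus: "\<lbrakk>f \<in> Hom D x y; g \<in> Hom D y z; g' \<in> Hom D y z\<rbrakk>
      \<Longrightarrow> (g \<boxplus> g') \<cdot> f = (g \<cdot> f) \<boxplus> (g' \<cdot> f)"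
    and Plus_Comp: "\<lbrakk>f \<in> Hom D x y; f' \<in> Hom D x y; g \<in> Hom D y z\<rbrakk>
      \<Longrightarrow> g \<cdot> (f \<boxplus> f') = (g \<cdot> f) \<boxplus> (g \<cdot> f')"
    and ex_zero_obj: "\<exists>z. zero_obj D z"
    and ex_direct_sum: "\<lbrakk>x \<in> Obj D; y \<in> Obj D\<rbrakk> \<Longrightarrow> \<exists>s. direct_sum D x y s"

section \<open>Triangulated categories\<close>

text \<open>\<open>ShO\<close> and \<open>ShA\<close> are the object and the arrow part of the shift functor. A triangle
  is a triple of arrows; its objects are recovered from domains and codomains.\<close>

record ('o, 'm) triangulated_data = "('o, 'm) additive_data" +
  ShO :: "'o \<Rightarrow> 'o"
  ShA :: "'m \<Rightarrow> 'm"
  Dist :: "('m \<times> 'm \<times> 'm) set"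

definition shift :: "('o, 'm, 'b) triangulated_data_scheme \<Rightarrow> 'o \<Rightarrow> nat \<Rightarrow> 'o" where
  "shift D x k = (ShO D ^^ k) x"

definition neg :: "('o, 'm, 'b) additive_data_scheme \<Rightarrow> 'm \<Rightarrow> 'm" where
  "neg D f = inv\<^bsub>Hom_group D (Dom D f) (Cod D f)\<^esub> f"

definition triangle ::
  "('o, 'm, 'b) triangulated_data_scheme \<Rightarrow> 'o \<Rightarrow> 'o \<Rightarrow> 'o \<Rightarrow> 'm \<Rightarrow> 'm \<Rightarrow> 'm \<Rightarrow> bool" where
  "triangle D x y z f g h \<longleftrightarrow> f \<in> Hom D x y \<and> g \<in> Hom D y z \<and> h \<in> Hom D z (ShO D x)"

definition dist_triangle ::
  "('o, 'm, 'b) triangulated_data_scheme \<Rightarrow> 'o \<Rightarrow> 'o \<Rightarrow> 'o \<Rightarrow> 'm \<Rightarrow> 'm \<Rightarrow> 'm \<Rightarrow> bool" where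
  "dist_triangle D x y z f g h \<longleftrightarrow> triangle D x y z f g h \<and> (f, g, h) \<in> Dist D"

text \<open>The shift is an additive self-equivalence; strict invertibility is not required.\<close>

locale triangulated_cat = additive_cat D
  for D :: "('o, 'm, 'b) triangulated_data_scheme" (structure) +
  assumes ShO_in: "x \<in> Obj D \<Longrightarrow> ShO D x \<in> Obj D"
    and ShA_Ident: "x \<in> Obj D \<Longrightarrow> ShA D (Ident D x) = Ident D (ShO D x)"
    and ShA_Comp: "\<lbrakk>f \<in> Hom D x y; g \<in> Hom D y z\<rbrakk> \<Longrightarrow> ShA D (g \<cdot> f) = ShA D g \<cdot> ShA D f"
    and ShA_Plus: "\<lbrakk>f \<in> Hom D x y; g \<in> Hom D x y\<rbrakk> \<Longrightarrow> ShA D (f \<boxplus> g) = ShA D f \<boxplus> ShA D g"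
    and ShA_bij: "\<lbrakk>x \<in> Obj D; y \<in> Obj D\<rbrakk>
      \<Longrightarrow> bij_betw (ShA D) (Hom D x y) (Hom D (ShO D x) (ShO D y))"
    and ShO_ess_surj: "y \<in> Obj D \<Longrightarrow> \<exists>x\<in>Obj D. \<exists>f. iso_arr D (ShO D x) y f"
    and TR1_iso: "\<lbrakk>dist_triangle D x y z f g h; triangle D x' y' z' f' g' h';
        iso_arr D x x' a; iso_arr D y y' b; iso_arr D z z' c;
        b \<cdot> f = f' \<cdot> a; c \<cdot> g = g' \<cdot> b; ShA D a \<cdot> h = h' \<cdot> c\<rbrakk>
      \<Longrightarrow> dist_triangle D x' y' z' f' g' h'"
    and TR1_Ident: "\<lbrakk>x \<in> Obj D; zero_obj D z\<rbrakk>
      \<Longrightarrow> dist_triangle D x x z (Ident D x) (Zero D x z) (Zero D z (ShO D x))"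
    and TR1_cone: "f \<in> Hom D x y \<Longrightarrow> \<exists>z g h. dist_triangle D x y z f g h"
    and TR2: "triangle D x y z f g h \<Longrightarrow>
      dist_triangle D x y z f g h \<longleftrightarrow> dist_triangle D y z (ShO D x) g h (neg D (ShA D f))"
    and TR3: "\<lbrakk>dist_triangle D x y z f g h; dist_triangle D x' y' z' f' g' h';
        a \<in> Hom D x x'; b \<in> Hom D y y'; b \<cdot> f = f' \<cdot> a\<rbrakk>
      \<Longrightarrow> \<exists>c\<in>Hom D z z'. c \<cdot> g = g' \<cdot> b \<and> ShA D a \<cdot> h = h' \<cdot> c"
    and TR4: "\<lbrakk>dist_triangle D x y u f f' f''; dist_triangle D y z w g g' g'';
        dist_triangle D x z v (g \<cdot> f) h' h''\<rbrakk>
      \<Longrightarrow> \<exists>a b. dist_triangle D u v w a b (ShA D f' \<cdot> g'') \<and>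
            a \<cdot> f' = h' \<cdot> g \<and> b \<cdot> h' = g' \<and> h'' \<cdot> a = f'' \<and> g'' \<cdot> b = ShA D f \<cdot> h''"

section \<open>Well generated triangulated categories\<close>

text \<open>Smallness is relative to a universe, given by a type \<open>'u\<close>: a set is small if its
  cardinality is strictly below that of \<open>'u\<close>. The usual reading, with respect to a
  Grothendieck universe, is the case where the cardinality of \<open>'u\<close> is strongly inaccessible;
  nothing here imposes this. As only the cardinality of index sets matters, subsets of \<open>'u\<close>
  suffice as index sets.\<close>

definition small_set :: "'u itself \<Rightarrow> 'a set \<Rightarrow> bool" where
  "small_set U A \<longleftrightarrow> |A| <o |UNIV :: 'u set|"

definition is_coproduct ::
  "('o, 'm, 'b) category_data_scheme \<Rightarrow> 'i set \<Rightarrow> ('i \<Rightarrow> 'o) \<Rightarrow> 'o \<Rightarrow> ('i \<Rightarrow> 'm) \<Rightarrow> bool" where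
  "is_coproduct D I X P \<iota> \<longleftrightarrow> P \<in> Obj D \<and> (\<forall>i\<in>I. \<iota> i \<in> Hom D (X i) P) \<and>
     (\<forall>Z\<in>Obj D. \<forall>g. (\<forall>i\<in>I. g i \<in> Hom D (X i) Z) \<longrightarrow>
        (\<exists>!h. h \<in> Hom D P Z \<and> (\<forall>i\<in>I. h \<cdot>\<^bsub>D\<^esub> \<iota> i = g i)))"

definition has_small_coproducts ::
  "'u itself \<Rightarrow> ('o, 'm, 'b) category_data_scheme \<Rightarrow> bool" where
  "has_small_coproducts U D \<longleftrightarrow>
     (\<forall>(I :: 'u set) X. small_set U I \<and> X ` I \<subseteq> Obj D \<longrightarrow> (\<exists>P \<iota>. is_coproduct D I X P \<iota>))"

definition Hom_surj :: "('o, 'm, 'b) category_data_scheme \<Rightarrow> 'o \<Rightarrow> 'm \<Rightarrow> bool" where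
  "Hom_surj D s f \<longleftrightarrow> (\<lambda>\<phi>. f \<cdot>\<^bsub>D\<^esub> \<phi>) ` Hom D s (Dom D f) = Hom D s (Cod D f)"

text \<open>An object \<open>s\<close> is \<open>\<kappa>\<close>-small if every map from \<open>s\<close> into a small coproduct factors through
  a subcoproduct over fewer than \<open>\<kappa>\<close> indices.\<close>

definition card_small_obj ::
  "'u itself \<Rightarrow> ('o, 'm, 'b) category_data_scheme \<Rightarrow> 'u rel \<Rightarrow> 'o \<Rightarrow> bool" where
  "card_small_obj U D \<kappa> s \<longleftrightarrow>
     (\<forall>(I :: 'u set) X P \<iota> f.
        small_set U I \<and> X ` I \<subseteq> Obj D \<and> is_coproduct D I X P \<iota> \<and> f \<in> Hom D s P \<longrightarrow>
        (\<exists>J\<subseteq>I. |J| <o \<kappa> \<and>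
           (\<exists>Q \<mu> c g. is_coproduct D J X Q \<mu> \<and>
              c \<in> Hom D Q P \<and> (\<forall>j\<in>J. c \<cdot>\<^bsub>D\<^esub> \<mu> j = \<iota> j) \<and>
              g \<in> Hom D s Q \<and> f = c \<cdot>\<^bsub>D\<^esub> g)))"

text \<open>Krause's conditions G1, G2, G3 on a set \<open>S\<close> of objects, the last with respect to a
  cardinal \<open>\<kappa>\<close>. In G2, \<open>h\<close> is the map induced by the family \<open>f\<close> on coproducts.\<close>

definition gen_G1 :: "('o, 'm, 'b) additive_data_scheme \<Rightarrow> 'o set \<Rightarrow> bool" where
  "gen_G1 D S \<longleftrightarrow>
     (\<forall>x\<in>Obj D. (\<forall>s\<in>S. Hom D s x = {Zero D s x}) \<longrightarrow> zero_obj D x)"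

definition gen_G2 :: "'u itself \<Rightarrow> ('o, 'm, 'b) category_data_scheme \<Rightarrow> 'o set \<Rightarrow> bool" where
  "gen_G2 U D S \<longleftrightarrow>
     (\<forall>(I :: 'u set) X Y f P \<iota> Q \<mu> h.
        small_set U I \<and> (\<forall>i\<in>I. f i \<in> Hom D (X i) (Y i)) \<and>
        is_coproduct D I X P \<iota> \<and> is_coproduct D I Y Q \<mu> \<and>
        h \<in> Hom D P Q \<and> (\<forall>i\<in>I. h \<cdot>\<^bsub>D\<^esub> \<iota> i = \<mu> i \<cdot>\<^bsub>D\<^esub> f i) \<and>
        (\<forall>i\<in>I. \<forall>s\<in>S. Hom_surj D s (f i)) \<longrightarrow>
        (\<forall>s\<in>S. Hom_surj D s h))"

definition gen_G3 ::
  "'u itself \<Rightarrow> ('o, 'm, 'b) category_data_scheme \<Rightarrow> 'o set \<Rightarrow> 'u rel \<Rightarrow> bool" where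
  "gen_G3 U D S \<kappa> \<longleftrightarrow> (\<forall>s\<in>S. card_small_obj U D \<kappa> s)"

definition well_generated ::
  "'u itself \<Rightarrow> ('o, 'm, 'b) triangulated_data_scheme \<Rightarrow> bool" where
  "well_generated U D \<longleftrightarrow>
     triangulated_cat D \<and>
     (\<forall>x\<in>Obj D. \<forall>y\<in>Obj D. small_set U (Hom D x y)) \<and>
     has_small_coproducts U D \<and>
     (\<exists>S\<subseteq>Obj D. small_set U S \<and> gen_G1 D S \<and> gen_G2 U D S \<and>
        (\<exists>\<kappa> :: 'u rel. Cinfinite \<kappa> \<and> regularCard \<kappa> \<and> \<kappa> <o |UNIV :: 'u set| \<and>
           gen_G3 U D S \<kappa>))"

section \<open>Positive orthogonals and universal maps\<close>

definition Hom_zero :: "('o, 'm, 'b) additive_data_scheme \<Rightarrow> 'o \<Rightarrow> 'o \<Rightarrow> bool" where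
  "Hom_zero D x y \<longleftrightarrow> Hom D x y = {Zero D x y}"

definition perp_pos :: "('o, 'm, 'b) triangulated_data_scheme \<Rightarrow> 'o \<Rightarrow> 'o set" where
  "perp_pos D x = {y \<in> Obj D. \<forall>i>0. Hom_zero D x (shift D y i)}"

definition left_universal :: "('o, 'm, 'b) category_data_scheme \<Rightarrow> 'o \<Rightarrow> 'o \<Rightarrow> 'm \<Rightarrow> bool" where
  "left_universal D M N \<alpha> \<longleftrightarrow> \<alpha> \<in> Hom D M N \<and>
     (\<lambda>\<phi>. \<alpha> \<cdot>\<^bsub>D\<^esub> \<phi>) ` Hom D M M = Hom D M N"

definition right_universal :: "('o, 'm, 'b) category_data_scheme \<Rightarrow> 'o \<Rightarrow> 'o \<Rightarrow> 'm \<Rightarrow> bool" where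
  "right_universal D M N \<alpha> \<longleftrightarrow> \<alpha> \<in> Hom D M N \<and>
     (\<lambda>\<phi>. \<phi> \<cdot>\<^bsub>D\<^esub> \<alpha>) ` Hom D N N = Hom D M N"

end

theory Submission
  imports Defs
begin

text \<open>Everything follows from the long exact sequences obtained by applying Hom out of and into
  an object to the triangle \<open>\<sigma>1 \<rightarrow> \<sigma>t \<rightarrow> \<sigma>2 \<rightarrow> \<sigma>1[1]\<close>, whose exactness is the content of
  \<open>Hom_exact_covariant\<close> and \<open>Hom_exact_contravariant\<close>.
  Since shifts commute with direct sums, \<open>x \<oplus> y\<close> lies in its own positive orthogonal iff the
  four groups \<open>Hom(x, x[i])\<close>, \<open>Hom(x, y[i])\<close>, \<open>Hom(y, x[i])\<close>, \<open>Hom(y, y[i])\<close> vanish for all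
  \<open>i > 0\<close> (\<open>direct_sum_in_perp_pos_iff\<close>).

  The vanishing hypotheses force \<open>Hom(\<sigma>t, \<sigma>2[i]) = 0\<close> and \<open>Hom(\<sigma>1, \<sigma>t[i]) = 0\<close> for all \<open>i > 0\<close>,
  and also \<open>Hom(\<sigma>2, \<sigma>t[i]) = 0\<close> and \<open>Hom(\<sigma>t, \<sigma>1[i]) = 0\<close> for all \<open>i \<ge> 2\<close>. In degree one the
  sequences
  \<open>Hom(\<sigma>2, \<sigma>2) \<rightarrow> Hom(\<sigma>2, \<sigma>1[1]) \<rightarrow> Hom(\<sigma>2, \<sigma>t[1]) \<rightarrow> Hom(\<sigma>2, \<sigma>2[1]) = 0\<close> and
  \<open>Hom(\<sigma>1[1], \<sigma>1[1]) \<rightarrow> Hom(\<sigma>2, \<sigma>1[1]) \<rightarrow> Hom(\<sigma>t, \<sigma>1[1]) \<rightarrow> Hom(\<sigma>1, \<sigma>1[1]) = 0\<close>, in which the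
  first maps are composition with \<open>\<alpha>\<close>, show that \<open>Hom(\<sigma>2, \<sigma>t[1])\<close> vanishes iff \<open>\<alpha>\<close> is left
  universal, and \<open>Hom(\<sigma>t, \<sigma>1[1])\<close> vanishes iff \<open>\<alpha>\<close> is right universal. The remaining groups
  \<open>Hom(\<sigma>t, \<sigma>t[i])\<close> are squeezed between \<open>Hom(\<sigma>2, \<sigma>t[i])\<close> and \<open>Hom(\<sigma>1, \<sigma>t[i]) = 0\<close>, and also
  between \<open>Hom(\<sigma>t, \<sigma>1[i])\<close> and \<open>Hom(\<sigma>t, \<sigma>2[i]) = 0\<close>, so they impose no further condition.\<close>

section \<open>Additive categories\<close>

context cat
begin

lemma Hom_objs:
  assumes "f \<in> Hom D x y"
  shows "x \<in> Obj D" "y \<in> Obj D"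
  using assms Dom_in Cod_in by (auto simp: Hom_def)

end

context additive_cat
begin

lemma Zero_in: "\<lbrakk>x \<in> Obj D; y \<in> Obj D\<rbrakk> \<Longrightarrow> Zero D x y \<in> Hom D x y"
  using comm_group.axioms(2)[OF Hom_comm_group, THEN group.is_monoid, THEN monoid.one_closed]
  by (simp add: Hom_group_def)

lemma Plus_Zero:
  assumes "f \<in> Hom D x y"
  shows "f \<boxplus> Zero D x y = f"
proof -
  interpret G: comm_group "Hom_group D x y"
    using Hom_comm_group Hom_objs assms by blast
  show ?thesis using G.r_one[of f] assms by (simp add: Hom_group_def)
qed

lemma Plus_idem_imp_Zero:
  assumes "f \<in> Hom D x y" "f \<boxplus> f = f"
  shows "f = Zero D x y"
proof -
  interpret G: comm_group "Hom_group D x y"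
    using Hom_comm_group Hom_objs assms by blast
  show ?thesis using G.l_cancel_one'[of f f] assms by (simp add: Hom_group_def)
qed

lemma neg_in:
  assumes "f \<in> Hom D x y"
  shows "neg D f \<in> Hom D x y"
proof -
  interpret G: comm_group "Hom_group D x y"
    using Hom_comm_group Hom_objs assms by blast
  show ?thesis using G.inv_closed[of f] assms by (simp add: Hom_group_def neg_def Hom_def)
qed

lemma Plus_neg:
  assumes "f \<in> Hom D x y"
  shows "f \<boxplus> neg D f = Zero D x y"
proof -
  interpret G: comm_group "Hom_group D x y"
    using Hom_comm_group Hom_objs assms by blast
  show ?thesis using G.r_inv[of f] assms by (simp add: Hom_group_def neg_def Hom_def)
qed

lemma neg_unique:
  assumes "f \<in> Hom D x y" "g \<in> Hom D x y" "f \<boxplus> g = Zero D x y"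
  shows "g = neg D f"
proof -
  interpret G: comm_group "Hom_group D x y"
    using Hom_comm_group Hom_objs assms by blast
  have "g \<boxplus> f = Zero D x y"
    using G.m_comm[of f g] assms by (simp add: Hom_group_def)
  then have "inv\<^bsub>Hom_group D x y\<^esub> f = g"
    using G.inv_equality[of g f] assms by (simp add: Hom_group_def)
  then show ?thesis using assms by (simp add: neg_def Hom_def)
qed

lemma neg_inj:
  assumes "f \<in> Hom D x y" "g \<in> Hom D x y" "neg D f = neg D g"
  shows "f = g"
proof -
  interpret G: comm_group "Hom_group D x y"
    using Hom_comm_group Hom_objs assms by blast
  have "inv\<^bsub>Hom_group D x y\<^esub> f = inv\<^bsub>Hom_group D x y\<^esub> g"
    using assms by (simp add: neg_def Hom_def)
  then show ?thesis
    using G.inv_inv[of f] G.inv_inv[of g] assms by (simp add: Hom_group_def)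
qed

lemma Zero_Comp:
  assumes "f \<in> Hom D x y" "z \<in> Obj D"
  shows "Zero D y z \<cdot> f = Zero D x z"
proof -
  have Z: "Zero D y z \<in> Hom D y z" using Zero_in Hom_objs assms by blast
  have "(Zero D y z \<cdot> f) \<boxplus> (Zero D y z \<cdot> f) = Zero D y z \<cdot> f"
    using Comp_Plus[OF assms(1) Z Z] Plus_Zero[OF Z] by simp
  then show ?thesis using Plus_idem_imp_Zero Comp_in assms(1) Z by blast
qed

lemma Comp_Zero:
  assumes "g \<in> Hom D y z" "x \<in> Obj D"
  shows "g \<cdot> Zero D x y = Zero D x z"
proof -
  have Z: "Zero D x y \<in> Hom D x y" using Zero_in Hom_objs assms by blast
  have "(g \<cdot> Zero D x y) \<boxplus> (g \<cdot> Zero D x y) = g \<cdot> Zero D x y"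
    using Plus_Comp[OF Z Z assms(1)] Plus_Zero[OF Z] by simp
  then show ?thesis using Plus_idem_imp_Zero Comp_in assms(1) Z by blast
qed

lemma neg_Comp:
  assumes "f \<in> Hom D x y" "g \<in> Hom D y z"
  shows "neg D g \<cdot> f = neg D (g \<cdot> f)"
proof (rule neg_unique)
  show "(g \<cdot> f) \<boxplus> (neg D g \<cdot> f) = Zero D x z"
    using Comp_Plus[OF assms neg_in[OF assms(2)]] Plus_neg[OF assms(2)]
      Zero_Comp[OF assms(1)] Hom_objs[OF assms(2)] by simp
qed (use Comp_in neg_in assms in blast)+

lemma Comp_neg:
  assumes "f \<in> Hom D x y" "g \<in> Hom D y z"
  shows "g \<cdot> neg D f = neg D (g \<cdot> f)"
proof (rule neg_unique)
  show "(g \<cdot> f) \<boxplus> (g \<cdot> neg D f) = Zero D x z"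
    using Plus_Comp[OF assms(1) neg_in[OF assms(1)] assms(2)] Plus_neg[OF assms(1)]
      Comp_Zero[OF assms(2)] Hom_objs[OF assms(1)] by simp
qed (use Comp_in neg_in assms in blast)+

lemma Hom_zeroI:
  assumes "x \<in> Obj D" "y \<in> Obj D" "\<And>f. f \<in> Hom D x y \<Longrightarrow> f = Zero D x y"
  shows "Hom_zero D x y"
  using Zero_in[OF assms(1,2)] assms(3) unfolding Hom_zero_def by blast

lemma Hom_zeroD: "\<lbrakk>Hom_zero D x y; f \<in> Hom D x y\<rbrakk> \<Longrightarrow> f = Zero D x y"
  by (simp add: Hom_zero_def)

lemma direct_sum_objs:
  assumes "direct_sum D x y s"
  shows "x \<in> Obj D" "y \<in> Obj D" "s \<in> Obj D"
  using assms Hom_objs unfolding direct_sum_def biproduct_def by blast+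

lemma Hom_zero_into_direct_sum:
  assumes s: "direct_sum D x y s" and w: "w \<in> Obj D"
  shows "Hom_zero D w s \<longleftrightarrow> Hom_zero D w x \<and> Hom_zero D w y"
proof -
  obtain i j p q where b: "biproduct D x y s i j p q"
    using s unfolding direct_sum_def by blast
  have i: "i \<in> Hom D x s" and j: "j \<in> Hom D y s" and p: "p \<in> Hom D s x" and q: "q \<in> Hom D s y"
    and pi: "p \<cdot> i = Ident D x" and qj: "q \<cdot> j = Ident D y"
    and split: "(i \<cdot> p) \<boxplus> (j \<cdot> q) = Ident D s"
    using b unfolding biproduct_def by auto
  note obj = direct_sum_objs[OF s]
  show ?thesis
  proof (intro iffI conjI)
    assume z: "Hom_zero D w s"
    show "Hom_zero D w x"
    proof (rule Hom_zeroI[OF w obj(1)])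
      fix f assume f: "f \<in> Hom D w x"
      have "f = p \<cdot> (i \<cdot> f)"
        using Comp_assoc[OF f i p] pi Ident_Comp[OF f] by simp
      also have "i \<cdot> f = Zero D w s" using Hom_zeroD[OF z] Comp_in[OF f i] by blast
      finally show "f = Zero D w x" using Comp_Zero[OF p w] by simp
    qed
    show "Hom_zero D w y"
    proof (rule Hom_zeroI[OF w obj(2)])
      fix f assume f: "f \<in> Hom D w y"
      have "f = q \<cdot> (j \<cdot> f)"
        using Comp_assoc[OF f j q] qj Ident_Comp[OF f] by simp
      also have "j \<cdot> f = Zero D w s" using Hom_zeroD[OF z] Comp_in[OF f j] by blast
      finally show "f = Zero D w y" using Comp_Zero[OF q w] by simp
    qed
  next
    assume z: "Hom_zero D w x \<and> Hom_zero D w y"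
    show "Hom_zero D w s"
    proof (rule Hom_zeroI[OF w obj(3)])
      fix f assume f: "f \<in> Hom D w s"
      have pf: "p \<cdot> f = Zero D w x" and qf: "q \<cdot> f = Zero D w y"
        using z Hom_zeroD Comp_in[OF f p] Comp_in[OF f q] by blast+
      have "f = ((i \<cdot> p) \<boxplus> (j \<cdot> q)) \<cdot> f"
        using split Ident_Comp[OF f] by simp
      also have "\<dots> = (i \<cdot> (p \<cdot> f)) \<boxplus> (j \<cdot> (q \<cdot> f))"
        using Comp_Plus[OF f Comp_in[OF p i] Comp_in[OF q j]]
          Comp_assoc[OF f p i] Comp_assoc[OF f q j] by simp
      also have "\<dots> = Zero D w s"
        using pf qf Comp_Zero[OF i w] Comp_Zero[OF j w] Plus_Zero[OF Zero_in[OF w obj(3)]] by simp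
      finally show "f = Zero D w s" .
    qed
  qed
qed

lemma Hom_zero_from_direct_sum:
  assumes s: "direct_sum D x y s" and w: "w \<in> Obj D"
  shows "Hom_zero D s w \<longleftrightarrow> Hom_zero D x w \<and> Hom_zero D y w"
proof -
  obtain i j p q where b: "biproduct D x y s i j p q"
    using s unfolding direct_sum_def by blast
  have i: "i \<in> Hom D x s" and j: "j \<in> Hom D y s" and p: "p \<in> Hom D s x" and q: "q \<in> Hom D s y"
    and pi: "p \<cdot> i = Ident D x" and qj: "q \<cdot> j = Ident D y"
    and split: "(i \<cdot> p) \<boxplus> (j \<cdot> q) = Ident D s"
    using b unfolding biproduct_def by auto
  note obj = direct_sum_objs[OF s]
  show ?thesis
  proof (intro iffI conjI)
    assume z: "Hom_zero D s w"
    show "Hom_zero D x w"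
    proof (rule Hom_zeroI[OF obj(1) w])
      fix f assume f: "f \<in> Hom D x w"
      have "f = (f \<cdot> p) \<cdot> i"
        using Comp_assoc[OF i p f] pi Comp_Ident[OF f] by simp
      also have "f \<cdot> p = Zero D s w" using Hom_zeroD[OF z] Comp_in[OF p f] by blast
      finally show "f = Zero D x w" using Zero_Comp[OF i w] by simp
    qed
    show "Hom_zero D y w"
    proof (rule Hom_zeroI[OF obj(2) w])
      fix f assume f: "f \<in> Hom D y w"
      have "f = (f \<cdot> q) \<cdot> j"
        using Comp_assoc[OF j q f] qj Comp_Ident[OF f] by simp
      also have "f \<cdot> q = Zero D s w" using Hom_zeroD[OF z] Comp_in[OF q f] by blast
      finally show "f = Zero D y w" using Zero_Comp[OF j w] by simp
    qed
  next
    assume z: "Hom_zero D x w \<and> Hom_zero D y w"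
    show "Hom_zero D s w"
    proof (rule Hom_zeroI[OF obj(3) w])
      fix f assume f: "f \<in> Hom D s w"
      have fi: "f \<cdot> i = Zero D x w" and fj: "f \<cdot> j = Zero D y w"
        using z Hom_zeroD Comp_in[OF i f] Comp_in[OF j f] by blast+
      have "f = f \<cdot> ((i \<cdot> p) \<boxplus> (j \<cdot> q))"
        using split Comp_Ident[OF f] by simp
      also have "\<dots> = ((f \<cdot> i) \<cdot> p) \<boxplus> ((f \<cdot> j) \<cdot> q)"
        using Plus_Comp[OF Comp_in[OF p i] Comp_in[OF q j] f]
          Comp_assoc[OF p i f] Comp_assoc[OF q j f] by simp
      also have "\<dots> = Zero D s w"
        using fi fj Zero_Comp[OF p w] Zero_Comp[OF q w] Plus_Zero[OF Zero_in[OF obj(3) w]] by simp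
      finally show "f = Zero D s w" .
    qed
  qed
qed

lemma zero_obj_iff_Ident_eq_Zero:
  assumes "z \<in> Obj D"
  shows "zero_obj D z \<longleftrightarrow> Ident D z = Zero D z z"
proof
  assume "zero_obj D z"
  then show "Ident D z = Zero D z z"
    using Ident_in[OF assms] assms unfolding zero_obj_def by blast
next
  assume eq: "Ident D z = Zero D z z"
  have "Hom D x z = {Zero D x z} \<and> Hom D z x = {Zero D z x}" if x: "x \<in> Obj D" for x
  proof -
    have "f = Zero D x z" if f: "f \<in> Hom D x z" for f
      using Ident_Comp[OF f] Zero_Comp[OF f assms] eq by simp
    moreover have "f = Zero D z x" if f: "f \<in> Hom D z x" for f
      using Comp_Ident[OF f] Comp_Zero[OF f assms] eq by simp
    ultimately show ?thesis using Zero_in assms x by blast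
  qed
  then show "zero_obj D z" using assms unfolding zero_obj_def by blast
qed

end

section \<open>The shift functor\<close>

context triangulated_cat
begin

lemma ShA_in:
  assumes "f \<in> Hom D x y"
  shows "ShA D f \<in> Hom D (ShO D x) (ShO D y)"
  using bij_betwE[OF ShA_bij[OF Hom_objs[OF assms]]] assms by blast

lemma ShA_Zero:
  assumes "x \<in> Obj D" "y \<in> Obj D"
  shows "ShA D (Zero D x y) = Zero D (ShO D x) (ShO D y)"
proof -
  note Z = Zero_in[OF assms]
  show ?thesis
    using Plus_idem_imp_Zero[OF ShA_in[OF Z]] ShA_Plus[OF Z Z] Plus_Zero[OF Z] by simp
qed

lemma zero_obj_ShO:
  assumes "zero_obj D z"
  shows "zero_obj D (ShO D z)"
proof -
  have z: "z \<in> Obj D" using assms by (simp add: zero_obj_def)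
  then show ?thesis
    using assms ShA_Ident ShA_Zero ShO_in by (metis zero_obj_iff_Ident_eq_Zero)
qed

lemma direct_sum_ShO:
  assumes "direct_sum D x y s"
  shows "direct_sum D (ShO D x) (ShO D y) (ShO D s)"
proof -
  obtain i j p q where b: "biproduct D x y s i j p q"
    using assms unfolding direct_sum_def by blast
  have h: "i \<in> Hom D x s" "j \<in> Hom D y s" "p \<in> Hom D s x" "q \<in> Hom D s y"
    and e: "p \<cdot> i = Ident D x" "q \<cdot> j = Ident D y" "p \<cdot> j = Zero D y x" "q \<cdot> i = Zero D x y"
      "(i \<cdot> p) \<boxplus> (j \<cdot> q) = Ident D s"
    using b unfolding biproduct_def by auto
  note obj = direct_sum_objs[OF assms]
  have "biproduct D (ShO D x) (ShO D y) (ShO D s) (ShA D i) (ShA D j) (ShA D p) (ShA D q)"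
    unfolding biproduct_def
    using ShA_in[OF h(1)] ShA_in[OF h(2)] ShA_in[OF h(3)] ShA_in[OF h(4)]
      ShA_Comp[OF h(1,3)] ShA_Comp[OF h(2,4)] ShA_Comp[OF h(2,3)] ShA_Comp[OF h(1,4)]
      ShA_Comp[OF h(3,1)] ShA_Comp[OF h(4,2)]
      ShA_Plus[OF Comp_in[OF h(3,1)] Comp_in[OF h(4,2)]]
      e ShA_Ident obj ShA_Zero by simp
  then show ?thesis using ShO_in obj unfolding direct_sum_def by blast
qed

lemma shift_in: "x \<in> Obj D \<Longrightarrow> shift D x k \<in> Obj D"
  unfolding shift_def by (induction k) (auto intro: ShO_in)

lemma direct_sum_shift:
  "direct_sum D x y s \<Longrightarrow> direct_sum D (shift D x k) (shift D y k) (shift D s k)"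
  unfolding shift_def by (induction k) (auto intro: direct_sum_ShO)

lemma direct_sum_in_perp_pos_iff:
  assumes "direct_sum D x y s"
  shows "s \<in> perp_pos D s \<longleftrightarrow>
    (\<forall>i>0. Hom_zero D x (shift D x i) \<and> Hom_zero D x (shift D y i) \<and>
           Hom_zero D y (shift D x i) \<and> Hom_zero D y (shift D y i))"
proof -
  note obj = direct_sum_objs[OF assms]
  have "Hom_zero D s (shift D s i) \<longleftrightarrow>
      Hom_zero D x (shift D x i) \<and> Hom_zero D x (shift D y i) \<and>
      Hom_zero D y (shift D x i) \<and> Hom_zero D y (shift D y i)" for i
    using Hom_zero_from_direct_sum[OF assms shift_in[OF obj(3)]]
      Hom_zero_into_direct_sum[OF direct_sum_shift[OF assms] obj(1)]
      Hom_zero_into_direct_sum[OF direct_sum_shift[OF assms] obj(2)] by blast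
  then show ?thesis using obj unfolding perp_pos_def by simp
qed

section \<open>Exact sequences of a distinguished triangle\<close>

lemma dist_triangle_arrs:
  assumes "dist_triangle D x y z f g h"
  shows "f \<in> Hom D x y" "g \<in> Hom D y z" "h \<in> Hom D z (ShO D x)"
  using assms unfolding dist_triangle_def triangle_def by auto

lemma dist_triangle_rotate:
  assumes "dist_triangle D x y z f g h"
  shows "dist_triangle D y z (ShO D x) g h (neg D (ShA D f))"
  using assms TR2 unfolding dist_triangle_def by blast

text \<open>Three rotations produce the shifted triangle with the signs of all three arrows reversed.
  The signs are irrelevant to exactness, so the arrows are left unspecified.\<close>

lemma dist_triangle_shift:
  assumes "dist_triangle D x y z f g h"
  shows "\<exists>f' g' h'. dist_triangle D (shift D x k) (shift D y k) (shift D z k) f' g' h'"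
proof (induction k)
  case 0
  then show ?case using assms by (auto simp: shift_def)
next
  case (Suc k)
  then show ?case
    using dist_triangle_rotate[OF dist_triangle_rotate[OF dist_triangle_rotate]]
    by (fastforce simp: shift_def)
qed

lemma dist_triangle_Comp_eq_Zero:
  assumes t: "dist_triangle D x y z f g h"
  shows "g \<cdot> f = Zero D x z"
proof -
  note arrs = dist_triangle_arrs[OF t]
  have x: "x \<in> Obj D" using Hom_objs arrs by blast
  obtain n where n: "zero_obj D n" using ex_zero_obj by blast
  \<comment> \<open>The square with sides \<open>Ident x\<close> and \<open>f\<close> extends to a morphism from the triangle
    \<open>x = x \<rightarrow> 0\<close>, which exhibits \<open>g \<cdot> f\<close> as a map through a zero object.\<close>
  obtain c where c: "c \<in> Hom D n z" "c \<cdot> Zero D x n = g \<cdot> f"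
    using TR3[OF TR1_Ident[OF x n] t Ident_in[OF x] arrs(1)] by blast
  then show ?thesis using Comp_Zero[OF c(1) x] by simp
qed

text \<open>Exactness of \<open>Hom(w, x) \<rightarrow> Hom(w, y) \<rightarrow> Hom(w, z)\<close> at the middle term.\<close>

lemma Hom_exact_covariant:
  assumes t: "dist_triangle D x y z f g h"
    and u: "u \<in> Hom D w y" and gu: "g \<cdot> u = Zero D w z"
  shows "\<exists>v\<in>Hom D w x. u = f \<cdot> v"
proof -
  note arrs = dist_triangle_arrs[OF t]
  have obj: "w \<in> Obj D" "x \<in> Obj D" "y \<in> Obj D" "z \<in> Obj D"
    using Hom_objs arrs u by blast+
  obtain n where n: "zero_obj D n" using ex_zero_obj by blast
  then have n_obj: "n \<in> Obj D" by (simp add: zero_obj_def)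
  note Z = Zero_in[OF n_obj obj(4)]
  \<comment> \<open>The rotated triangle of \<open>w = w \<rightarrow> 0\<close> is mapped to the rotated given triangle; the third
    component is the shift of the wanted factorisation, since the shift is fully faithful.\<close>
  have sq: "Zero D n z \<cdot> Zero D w n = g \<cdot> u"
    using gu Comp_Zero[OF Z obj(1)] by simp
  obtain c where c: "c \<in> Hom D (ShO D w) (ShO D x)"
    and ce: "ShA D u \<cdot> neg D (ShA D (Ident D w)) = neg D (ShA D f) \<cdot> c"
    using TR3[OF dist_triangle_rotate[OF TR1_Ident[OF obj(1) n]] dist_triangle_rotate[OF t] u Z sq]
    by blast
  obtain v where v: "v \<in> Hom D w x" "c = ShA D v"
    using ShA_bij[OF obj(1,2)] c unfolding bij_betw_def by blast
  note fv = Comp_in[OF v(1) arrs(1)]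
  have "neg D (ShA D u) = ShA D u \<cdot> neg D (ShA D (Ident D w))"
    using Comp_neg[OF ShA_in[OF Ident_in[OF obj(1)]] ShA_in[OF u]] ShA_Ident[OF obj(1)]
      Comp_Ident[OF ShA_in[OF u]] by simp
  also have "\<dots> = neg D (ShA D (f \<cdot> v))"
    using ce v neg_Comp[OF ShA_in[OF v(1)] ShA_in[OF arrs(1)]] ShA_Comp[OF v(1) arrs(1)] by simp
  finally have "ShA D u = ShA D (f \<cdot> v)"
    using neg_inj ShA_in u fv by blast
  then have "u = f \<cdot> v"
    using ShA_bij[OF obj(1,3)] u fv unfolding bij_betw_def inj_on_def by blast
  then show ?thesis using v by blast
qed

text \<open>Exactness of \<open>Hom(z, w) \<rightarrow> Hom(y, w) \<rightarrow> Hom(x, w)\<close> at the middle term.\<close>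

lemma Hom_exact_contravariant:
  assumes t: "dist_triangle D x y z f g h"
    and u: "u \<in> Hom D y w" and uf: "u \<cdot> f = Zero D x w"
  shows "\<exists>v\<in>Hom D z w. u = v \<cdot> g"
proof -
  note arrs = dist_triangle_arrs[OF t]
  have obj: "w \<in> Obj D" "x \<in> Obj D"
    using Hom_objs arrs u by blast+
  obtain n where n: "zero_obj D n" using ex_zero_obj by blast
  then have n_obj: "n \<in> Obj D" by (simp add: zero_obj_def)
  note So = zero_obj_ShO[OF n]
  \<comment> \<open>Rotating \<open>0 \<rightarrow> w = w\<close> gives the identity triangle of \<open>w\<close> with third object \<open>ShO 0\<close>.\<close>
  have Znw: "Zero D n w \<in> Hom D n w" using Zero_in n_obj obj by blast
  have "neg D (ShA D (Zero D n w)) = Zero D (ShO D n) (ShO D w)"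
    using neg_in[OF ShA_in[OF Znw]] So ShO_in[OF obj(1)] unfolding zero_obj_def by blast
  then have "dist_triangle D w w (ShO D n) (Ident D w) (Zero D w (ShO D n))
      (neg D (ShA D (Zero D n w)))"
    using TR1_Ident[OF obj(1) So] by simp
  moreover have "triangle D n w w (Zero D n w) (Ident D w) (Zero D w (ShO D n))"
    unfolding triangle_def using Znw Ident_in obj Zero_in ShO_in n_obj by blast
  ultimately have t0: "dist_triangle D n w w (Zero D n w) (Ident D w) (Zero D w (ShO D n))"
    using TR2 by blast
  have Zxn: "Zero D x n \<in> Hom D x n" using Zero_in obj n_obj by blast
  have "u \<cdot> f = Zero D n w \<cdot> Zero D x n"
    using uf Zero_Comp[OF Zxn obj(1)] by simp
  then obtain c where "c \<in> Hom D z w" "c \<cdot> g = Ident D w \<cdot> u"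
    using TR3[OF t t0 Zxn u] by blast
  then show ?thesis using Ident_Comp[OF u] by auto
qed

lemma Hom_zero_to_middle:
  assumes t: "dist_triangle D x y z f g h"
    and wx: "Hom_zero D w x" and wz: "Hom_zero D w z" and w: "w \<in> Obj D"
  shows "Hom_zero D w y"
proof (rule Hom_zeroI[OF w])
  note arrs = dist_triangle_arrs[OF t]
  show "y \<in> Obj D" using Hom_objs arrs by blast
  fix u assume u: "u \<in> Hom D w y"
  have "g \<cdot> u = Zero D w z" using Hom_zeroD[OF wz Comp_in[OF u arrs(2)]] .
  then obtain v where v: "v \<in> Hom D w x" "u = f \<cdot> v"
    using Hom_exact_covariant[OF t u] by blast
  then show "u = Zero D w y" using Hom_zeroD[OF wx v(1)] Comp_Zero[OF arrs(1) w] by simp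
qed

lemma Hom_zero_from_middle:
  assumes t: "dist_triangle D x y z f g h"
    and xw: "Hom_zero D x w" and zw: "Hom_zero D z w" and w: "w \<in> Obj D"
  shows "Hom_zero D y w"
proof (rule Hom_zeroI[OF _ w])
  note arrs = dist_triangle_arrs[OF t]
  show "y \<in> Obj D" using Hom_objs arrs by blast
  fix u assume u: "u \<in> Hom D y w"
  have "u \<cdot> f = Zero D x w" using Hom_zeroD[OF xw Comp_in[OF arrs(1) u]] .
  then obtain v where v: "v \<in> Hom D z w" "u = v \<cdot> g"
    using Hom_exact_contravariant[OF t u] by blast
  then show "u = Zero D y w" using Hom_zeroD[OF zw v(1)] Zero_Comp[OF arrs(2) w] by simp
qed

section \<open>Universal connecting morphisms\<close>

lemma left_universal_iff_Hom_zero: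
  assumes t: "dist_triangle D x y z f g h" and zz: "Hom_zero D z (ShO D z)"
  shows "left_universal D z (ShO D x) h \<longleftrightarrow> Hom_zero D z (ShO D y)"
proof -
  note arrs = dist_triangle_arrs[OF t]
  note t2 = dist_triangle_rotate[OF dist_triangle_rotate[OF t]]
  note t3 = dist_triangle_rotate[OF t2]
  have z: "z \<in> Obj D" using Hom_objs arrs by blast
  have Sy: "ShO D y \<in> Obj D" using Hom_objs arrs ShO_in by blast
  define k where "k = neg D (ShA D f)"
  have k: "k \<in> Hom D (ShO D x) (ShO D y)"
    unfolding k_def using neg_in ShA_in arrs(1) by blast
  show ?thesis
  proof
    assume lu: "left_universal D z (ShO D x) h"
    show "Hom_zero D z (ShO D y)"
    proof (rule Hom_zeroI[OF z Sy])
      fix u assume u: "u \<in> Hom D z (ShO D y)"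
      have "neg D (ShA D g) \<cdot> u = Zero D z (ShO D z)"
        using Hom_zeroD[OF zz Comp_in[OF u neg_in[OF ShA_in[OF arrs(2)]]]] .
      then obtain v where v: "v \<in> Hom D z (ShO D x)" "u = k \<cdot> v"
        using Hom_exact_covariant[OF t3 u] unfolding k_def by blast
      obtain \<phi> where \<phi>: "\<phi> \<in> Hom D z z" "v = h \<cdot> \<phi>"
        using lu v(1) unfolding left_universal_def by blast
      have "u = (k \<cdot> h) \<cdot> \<phi>" using v \<phi> Comp_assoc[OF \<phi>(1) arrs(3) k] by simp
      then show "u = Zero D z (ShO D y)"
        using dist_triangle_Comp_eq_Zero[OF t2] Zero_Comp[OF \<phi>(1) Sy] unfolding k_def by simp
    qed
  next
    assume zy: "Hom_zero D z (ShO D y)"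
    have "\<exists>\<phi>\<in>Hom D z z. u = h \<cdot> \<phi>" if u: "u \<in> Hom D z (ShO D x)" for u
      using Hom_exact_covariant[OF t2 u] Hom_zeroD[OF zy Comp_in[OF u k]] unfolding k_def by blast
    then show "left_universal D z (ShO D x) h"
      unfolding left_universal_def using arrs(3) Comp_in by blast
  qed
qed

lemma right_universal_iff_Hom_zero:
  assumes t: "dist_triangle D x y z f g h" and xx: "Hom_zero D x (ShO D x)"
  shows "right_universal D z (ShO D x) h \<longleftrightarrow> Hom_zero D y (ShO D x)"
proof -
  note arrs = dist_triangle_arrs[OF t]
  note t1 = dist_triangle_rotate[OF t]
  have y: "y \<in> Obj D" and Sx: "ShO D x \<in> Obj D" using Hom_objs arrs by blast+
  show ?thesis
  proof
    assume ru: "right_universal D z (ShO D x) h"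
    show "Hom_zero D y (ShO D x)"
    proof (rule Hom_zeroI[OF y Sx])
      fix u assume u: "u \<in> Hom D y (ShO D x)"
      obtain v where v: "v \<in> Hom D z (ShO D x)" "u = v \<cdot> g"
        using Hom_exact_contravariant[OF t u] Hom_zeroD[OF xx Comp_in[OF arrs(1) u]] by blast
      obtain \<phi> where \<phi>: "\<phi> \<in> Hom D (ShO D x) (ShO D x)" "v = \<phi> \<cdot> h"
        using ru v(1) unfolding right_universal_def by blast
      have "u = \<phi> \<cdot> (h \<cdot> g)" using v \<phi> Comp_assoc[OF arrs(2,3) \<phi>(1)] by simp
      then show "u = Zero D y (ShO D x)"
        using dist_triangle_Comp_eq_Zero[OF t1] Comp_Zero[OF \<phi>(1) y] by simp
    qed
  next
    assume yx: "Hom_zero D y (ShO D x)"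
    have "\<exists>\<phi>\<in>Hom D (ShO D x) (ShO D x). u = \<phi> \<cdot> h" if u: "u \<in> Hom D z (ShO D x)" for u
      using Hom_exact_contravariant[OF t1 u] Hom_zeroD[OF yx Comp_in[OF arrs(2) u]] by blast
    then show "right_universal D z (ShO D x) h"
      unfolding right_universal_def using arrs(3) Comp_in by blast
  qed
qed

end

section \<open>Self-orthogonality of the extension\<close>

theorem proposition2p5:
  fixes D :: "('o, 'm, 'b) triangulated_data_scheme"
    and \<sigma>1 \<sigma>2 \<sigma>t :: 'o
    and \<alpha> \<beta> \<gamma> :: 'm
  assumes "well_generated TYPE('u) D"
    and "\<sigma>1 \<in> Obj D" and "\<sigma>2 \<in> Obj D"
    and "\<And>k. k > 0 \<Longrightarrow> Hom_zero D \<sigma>1 (shift D \<sigma>1 k)"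
    and "\<And>k. k > 0 \<Longrightarrow> Hom_zero D \<sigma>2 (shift D \<sigma>2 k)"
    and "\<And>k. k \<ge> 0 \<Longrightarrow> Hom_zero D \<sigma>1 (shift D \<sigma>2 k)"
    and "\<And>k. k \<ge> 2 \<Longrightarrow> Hom_zero D \<sigma>2 (shift D \<sigma>1 k)"
    and "\<alpha> \<in> Hom D \<sigma>2 (shift D \<sigma>1 1)"
    and "dist_triangle D \<sigma>1 \<sigma>t \<sigma>2 \<beta> \<gamma> \<alpha>"
  shows "(\<forall>s. direct_sum D \<sigma>t \<sigma>2 s \<longrightarrow>
            (s \<in> perp_pos D s \<longleftrightarrow> left_universal D \<sigma>2 (shift D \<sigma>1 1) \<alpha>)) \<and>
         (\<forall>s. direct_sum D \<sigma>t \<sigma>1 s \<longrightarrow>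
            (s \<in> perp_pos D s \<longleftrightarrow> right_universal D \<sigma>2 (shift D \<sigma>1 1) \<alpha>))"
proof -
  interpret triangulated_cat D using assms(1) unfolding well_generated_def by blast
  note t = assms(9)
  have t_obj: "\<sigma>t \<in> Obj D" using Hom_objs dist_triangle_arrs[OF t] by blast
  have shift1: "shift D x 1 = ShO D x" for x by (simp add: shift_def)
  have s11: "Hom_zero D \<sigma>1 (shift D \<sigma>1 i)" and s22: "Hom_zero D \<sigma>2 (shift D \<sigma>2 i)"
    if "i > 0" for i using assms(4,5) that by blast+
  have into_t: "Hom_zero D w (shift D \<sigma>t i)"
    if "Hom_zero D w (shift D \<sigma>1 i)" "Hom_zero D w (shift D \<sigma>2 i)" "w \<in> Obj D" for w i
    using dist_triangle_shift[OF t, of i] Hom_zero_to_middle that by blast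
  have st2: "Hom_zero D \<sigma>t (shift D \<sigma>2 i)" if "i > 0" for i
    using Hom_zero_from_middle[OF t] assms(6) s22[OF that] shift_in[OF assms(3)] by blast
  have s1t: "Hom_zero D \<sigma>1 (shift D \<sigma>t i)" if "i > 0" for i
    using into_t s11[OF that] assms(6) assms(2) by blast
  have left: "(\<forall>i>0. Hom_zero D \<sigma>2 (shift D \<sigma>t i)) \<longleftrightarrow> left_universal D \<sigma>2 (shift D \<sigma>1 1) \<alpha>"
  proof -
    have "Hom_zero D \<sigma>2 (shift D \<sigma>t i)" if "i \<ge> 2" for i
      using into_t[of \<sigma>2 i] assms(3,5,7) that by simp
    then have "(\<forall>i>0. Hom_zero D \<sigma>2 (shift D \<sigma>t i)) \<longleftrightarrow> Hom_zero D \<sigma>2 (shift D \<sigma>t 1)"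
      by (metis One_nat_def Suc_leI le_neq_implies_less less_one numeral_2_eq_2)
    then show ?thesis
      using left_universal_iff_Hom_zero[OF t] s22[of 1] shift1 by simp
  qed
  have right: "(\<forall>i>0. Hom_zero D \<sigma>t (shift D \<sigma>1 i)) \<longleftrightarrow> right_universal D \<sigma>2 (shift D \<sigma>1 1) \<alpha>"
  proof -
    have "Hom_zero D \<sigma>t (shift D \<sigma>1 i)" if "i \<ge> 2" for i
      using Hom_zero_from_middle[OF t s11[of i] assms(7)[OF that] shift_in[OF assms(2)]] that
      by simp
    then have "(\<forall>i>0. Hom_zero D \<sigma>t (shift D \<sigma>1 i)) \<longleftrightarrow> Hom_zero D \<sigma>t (shift D \<sigma>1 1)"
      by (metis One_nat_def Suc_leI le_neq_implies_less less_one numeral_2_eq_2)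
    then show ?thesis
      using right_universal_iff_Hom_zero[OF t] s11[of 1] shift1 by simp
  qed
  have tt_left: "Hom_zero D \<sigma>t (shift D \<sigma>t i)"
    if "i > 0" "Hom_zero D \<sigma>2 (shift D \<sigma>t i)" for i
    using Hom_zero_from_middle[OF t s1t[OF that(1)] that(2) shift_in[OF t_obj]] .
  have tt_right: "Hom_zero D \<sigma>t (shift D \<sigma>t i)"
    if "i > 0" "Hom_zero D \<sigma>t (shift D \<sigma>1 i)" for i
    using into_t[OF that(2) st2[OF that(1)] t_obj] .
  show ?thesis
  proof (intro conjI allI impI)
    fix s assume "direct_sum D \<sigma>t \<sigma>2 s"
    then show "s \<in> perp_pos D s \<longleftrightarrow> left_universal D \<sigma>2 (shift D \<sigma>1 1) \<alpha>"
      unfolding left[symmetric] using direct_sum_in_perp_pos_iff tt_left st2 s22 by blast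
  next
    fix s assume "direct_sum D \<sigma>t \<sigma>1 s"
    then show "s \<in> perp_pos D s \<longleftrightarrow> right_universal D \<sigma>2 (shift D \<sigma>1 1) \<alpha>"
      unfolding right[symmetric] using direct_sum_in_perp_pos_iff tt_right s1t s11 by blast
  qed
qed

end
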